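(* Let $X$ be a nontrivial complex Banach space and let $L:X\to X$ be an invertible bounded linear operator with bounded inverse. If $L$ is uniformly expansive and has the topological shadowing property, then $\sigma(L)\subset\mathbb{D}$ or $\sigma(L)\subset\mathbb{C}\setminus\overline{\mathbb{D}}$.
   Context: $\mathbb{D}$ is the open unit disk in $\mathbb{C}$ and $\overline{\mathbb{D}}$ its closure. The spectrum $\sigma(L)$ is the set of $\lambda\in\mathbb{C}$ such that $L-\lambda I$ is not invertible. "Nontrivial" means of positive dimension. $L$ is uniformly expansive if there exists a positive integer $m$ such that for every $x\in X$ with $\|x\|=1$ one has $\|L^m(x)\|\geq 2$ or $\|L^{-m}(x)\|\geq 2$. For a metric space $Y$, $C^+(Y)$ denotes the set of all continuous functions $\delta:Y\to(0,\infty)$. Let $f:Y\to Y$ be a bijective map. For $\delta\in C^+(Y)$, a sequence $(x_n)_{n\in\mathbb{Z}}$ in $Y$ is a $\delta$-pseudo orbit of $f$ if $d(f(x_n),x_{n+1})<\delta(f(x_n))$ for all $n\in\mathbb{Z}$; it can be $\delta$-shadowed if there is $x\in Y$ such that $d(f^n(x),x_n)<\delta(f^n(x))$ for all $n\in\mathbb{Z}$. The map $f$ has the topological shadowing property if for every $\epsilon\in C^+(Y)$ there exists $\delta\in C^+(Y)$ such that every $\delta$-pseudo orbit of $f$ can be $\epsilon$-shadowed. A Banach space is regarded as a metric space with the metric induced by its norm. *)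

theory Defs
  imports "HOL-Analysis.Analysis"
begin

text \<open>
  Complex Banach spaces are real Banach spaces with a compatible complex scalar multiplication,
  so that the norm, metric and topology are those of \<^class>\<open>banach\<close>.
\<close>

class complex_normed_vector = real_normed_vector +
  fixes scaleC :: "complex \<Rightarrow> 'a \<Rightarrow> 'a"  (infixr \<open>*\<^sub>C\<close> 75)
  assumes scaleC_add_right: "c *\<^sub>C (x + y) = c *\<^sub>C x + c *\<^sub>C y"
    and scaleC_add_left: "(c + d) *\<^sub>C x = c *\<^sub>C x + d *\<^sub>C x"
    and scaleC_scaleC: "c *\<^sub>C d *\<^sub>C x = (c * d) *\<^sub>C x"
    and scaleC_one: "1 *\<^sub>C x = x"
    and scaleR_scaleC: "r *\<^sub>R x = complex_of_real r *\<^sub>C x"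
    and norm_scaleC: "norm (c *\<^sub>C x) = cmod c * norm x"

class complex_banach = complex_normed_vector + banach

instantiation complex :: complex_banach
begin

definition scaleC_complex :: "complex \<Rightarrow> complex \<Rightarrow> complex"
  where "scaleC_complex c x = c * x"

instance
  by standard (simp_all add: scaleC_complex_def distrib_left distrib_right mult.assoc norm_mult scaleR_conv_of_real)

end

definition bounded_clinear ::
  "('a::complex_normed_vector \<Rightarrow> 'b::complex_normed_vector) \<Rightarrow> bool"
  where "bounded_clinear T \<longleftrightarrow> bounded_linear T \<and> (\<forall>c x. T (c *\<^sub>C x) = c *\<^sub>C T x)"

definition invertible_operator :: "('a::complex_normed_vector \<Rightarrow> 'a) \<Rightarrow> bool"
  where "invertible_operator T \<longleftrightarrow> (\<exists>S. bounded_clinear S \<and> S \<circ> T = id \<and> T \<circ> S = id)"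

definition spectrum :: "('a::complex_normed_vector \<Rightarrow> 'a) \<Rightarrow> complex set"
  where "spectrum T = {z. \<not> invertible_operator (\<lambda>x. T x - z *\<^sub>C x)}"

text \<open>
  Integer iterates; the negative ones are meaningful for bijective \<open>f\<close> only. The predicates below
  are likewise meant for bijections.
\<close>

definition iterate :: "('a \<Rightarrow> 'a) \<Rightarrow> int \<Rightarrow> 'a \<Rightarrow> 'a"
  where "iterate f n = (if 0 \<le> n then f ^^ nat n else inv f ^^ nat (- n))"

definition uniformly_expansive :: "('a::real_normed_vector \<Rightarrow> 'a) \<Rightarrow> bool"
  where "uniformly_expansive L \<longleftrightarrow>
    (\<exists>m::nat. 0 < m \<and> (\<forall>x. norm x = 1 \<longrightarrow>
      2 \<le> norm (iterate L (int m) x) \<or> 2 \<le> norm (iterate L (- int m) x)))"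

definition Cplus :: "('a::metric_space \<Rightarrow> real) set"
  where "Cplus = {\<delta>. continuous_on UNIV \<delta> \<and> (\<forall>y. 0 < \<delta> y)}"

definition pseudo_orbit ::
  "('a::metric_space \<Rightarrow> 'a) \<Rightarrow> ('a \<Rightarrow> real) \<Rightarrow> (int \<Rightarrow> 'a) \<Rightarrow> bool"
  where "pseudo_orbit f \<delta> x \<longleftrightarrow> (\<forall>n. dist (f (x n)) (x (n + 1)) < \<delta> (f (x n)))"

definition shadowed ::
  "('a::metric_space \<Rightarrow> 'a) \<Rightarrow> ('a \<Rightarrow> real) \<Rightarrow> (int \<Rightarrow> 'a) \<Rightarrow> bool"
  where "shadowed f \<delta> x \<longleftrightarrow> (\<exists>z. \<forall>n. dist (iterate f n z) (x n) < \<delta> (iterate f n z))"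

definition topological_shadowing :: "('a::metric_space \<Rightarrow> 'a) \<Rightarrow> bool"
  where "topological_shadowing f \<longleftrightarrow>
    (\<forall>\<epsilon>\<in>Cplus. \<exists>\<delta>\<in>Cplus. \<forall>x. pseudo_orbit f \<delta> x \<longrightarrow> shadowed f \<epsilon> x)"

end

theory Submission
  imports Defs
begin

text \<open>
  Let \<open>S\<close> and \<open>U\<close> be the subspaces of vectors whose forward, respectively backward, orbit under
  \<open>L\<close> is bounded. By uniform expansivity, a vector that is at least doubled by \<open>L ^^ m\<close> keeps being
  doubled, so that \<open>L ^^ m\<close> at least halves the norm on \<open>S\<close> (\<open>bounded_orbit_contracts\<close>) and, by symmetry,
  \<open>inv L ^^ m\<close> does so on \<open>U\<close>. In particular \<open>S\<close> and \<open>U\<close> meet only in \<open>0\<close>.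

  Shadowing is applied with the error \<open>exp (- norm y)\<close>, which is bounded but decays quickly at
  infinity. If \<open>a\<close> and \<open>b\<close> are close, the backward orbit of \<open>a\<close> followed by the forward orbit of
  \<open>b\<close> is a pseudo orbit, shadowed by the orbit of some \<open>z\<close> (\<open>shadowing_switch\<close>). Boundedness of the
  error gives \<open>z - b \<in> S\<close> and \<open>z - a \<in> U\<close>; with \<open>a = 0\<close> and after scaling, the whole space is the
  sum of \<open>S\<close> and \<open>U\<close>. The decay of the error excludes that both are nontrivial: for nonzero
  \<open>a \<in> S\<close> and \<open>b \<in> U\<close> the only candidate is \<open>z = a + b\<close>, and along its exponentially growing
  orbit the remaining deviation, the orbit of \<open>a\<close>, is too large (\<open>no_shadowed_switch\<close>).

  Hence \<open>S\<close> or \<open>U\<close> is everything, and \<open>L ^^ m\<close> or \<open>inv L ^^ m\<close> at least halves all norms. In the first case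
  \<open>1 - inverse z L\<close> is invertible whenever \<open>1 \<le> cmod z\<close>, in the second case \<open>1 - z (inv L)\<close> is
  invertible whenever \<open>cmod z \<le> 1\<close>, because some power of the subtracted operator is a contraction
  (\<open>invertible_id_minus_power_contraction\<close>).
\<close>

section \<open>Invertible operators\<close>

lemma scaleC_diff_right: "c *\<^sub>C (x - y) = c *\<^sub>C x - c *\<^sub>C (y::'a::complex_normed_vector)"
  using scaleC_add_right[of c "x - y" y] by (simp add: algebra_simps)

lemma scaleC_minus_left: "(- c) *\<^sub>C x = - (c *\<^sub>C (x::'a::complex_normed_vector))"
  using scaleC_add_left[of "- c" c x] scaleR_scaleC[of 0 x] by (simp add: eq_neg_iff_add_eq_0)

lemma bounded_clinear_scaleC: "bounded_clinear (\<lambda>x::'a::complex_normed_vector. c *\<^sub>C x)"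
  unfolding bounded_clinear_def
proof (intro conjI allI)
  show "bounded_linear (\<lambda>x::'a. c *\<^sub>C x)"
    by (rule bounded_linear_intro[where K = "cmod c"])
      (simp_all add: scaleC_add_right scaleR_scaleC scaleC_scaleC norm_scaleC mult.commute)
qed (simp add: scaleC_scaleC mult.commute)

lemma bounded_clinear_comp:
  "bounded_clinear S \<Longrightarrow> bounded_clinear T \<Longrightarrow> bounded_clinear (S \<circ> T)"
  by (simp add: bounded_clinear_def bounded_linear_compose comp_def)

lemma bounded_clinear_diff:
  "bounded_clinear S \<Longrightarrow> bounded_clinear T \<Longrightarrow> bounded_clinear (\<lambda>x. S x - T x)"
  by (simp add: bounded_clinear_def bounded_linear_sub scaleC_diff_right)

lemma linear_inv:
  fixes T T' :: "'a::real_vector \<Rightarrow> 'a"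
  assumes "linear T" and "\<And>x. T (T' x) = x" and left: "\<And>x. T' (T x) = x"
  shows "linear T'"
proof (rule linearI)
  show "T' (x + y) = T' x + T' y" for x y
    using left[of "T' x + T' y"] by (simp add: linear_add[OF assms(1)] assms(2))
  show "T' (r *\<^sub>R x) = r *\<^sub>R T' x" for r x
    using left[of "r *\<^sub>R T' x"] by (simp add: linear_scale[OF assms(1)] assms(2))
qed

lemma linear_funpow:
  fixes T :: "'a::real_vector \<Rightarrow> 'a"
  assumes "linear T"
  shows "linear (T ^^ n)"
proof (induction n)
  case (Suc n)
  then show ?case
    using linear_compose[OF Suc assms] by (simp add: comp_def)
qed (simp add: id_def linear_ident)

lemma bounded_linear_funpow:
  fixes T :: "'a::real_normed_vector \<Rightarrow> 'a"
  assumes "bounded_linear T"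
  shows "bounded_linear (T ^^ n)"
  by (induction n) (simp_all add: id_def comp_def bounded_linear_compose[OF assms])

lemma invertible_operator_comp:
  assumes "invertible_operator S" "invertible_operator T"
  shows "invertible_operator (S \<circ> T)"
proof -
  obtain S' T' where "bounded_clinear S'" "S' \<circ> S = id" "S \<circ> S' = id"
    and "bounded_clinear T'" "T' \<circ> T = id" "T \<circ> T' = id"
    using assms unfolding invertible_operator_def by blast
  then show ?thesis
    unfolding invertible_operator_def
    by (intro exI[of _ "T' \<circ> S'"])
      (simp add: bounded_clinear_comp fun_eq_iff)
qed

lemma invertible_operator_scaleC:
  assumes "c \<noteq> 0"
  shows "invertible_operator (\<lambda>x::'a::complex_normed_vector. c *\<^sub>C x)"
  unfolding invertible_operator_def using assms
  by (intro exI[of _ "\<lambda>x. inverse c *\<^sub>C x"])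
    (simp add: bounded_clinear_scaleC fun_eq_iff scaleC_scaleC scaleC_one)

lemma invertible_operatorI_bounded_below:
  fixes T :: "'a::complex_normed_vector \<Rightarrow> 'a"
  assumes T: "bounded_clinear T" and "surj T" and below: "\<And>x. norm x \<le> C * norm (T x)"
  shows "invertible_operator T"
proof -
  have lin: "linear T" and C_lin: "T (c *\<^sub>C x) = c *\<^sub>C T x" for c x
    using T by (simp_all add: bounded_clinear_def bounded_linear.linear)
  have "inj T"
    using below by (auto simp: linear_injective_0[OF lin]) (metis norm_le_zero_iff mult_zero_right norm_zero)
  with \<open>surj T\<close> have inv: "T (inv T y) = y" "inv T (T x) = x" for x y
    by (simp_all add: surj_f_inv_f inv_f_f)
  have lin_inv: "linear (inv T)"
    using linear_inv[OF lin inv] .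
  have "bounded_linear (inv T)"
  proof (rule bounded_linear_intro)
    show "inv T (x + y) = inv T x + inv T y" "inv T (r *\<^sub>R x) = r *\<^sub>R inv T x" for x y r
      by (simp_all add: linear_add[OF lin_inv] linear_scale[OF lin_inv])
    show "norm (inv T x) \<le> norm x * C" for x
      using below[of "inv T x"] by (simp add: inv mult.commute)
  qed
  moreover have "inv T (c *\<^sub>C x) = c *\<^sub>C inv T x" for c x
    using inv(2)[of "c *\<^sub>C inv T x"] by (simp add: C_lin inv(1))
  ultimately show ?thesis
    unfolding invertible_operator_def
    by (intro exI[of _ "inv T"]) (simp add: bounded_clinear_def fun_eq_iff inv)
qed

text \<open>
  The equation \<open>x - T x = y\<close> asks for a fixed point of the affine map \<open>x \<mapsto> T x + y\<close>. Its \<open>m\<close>-th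
  iterate is a contraction, and the unique fixed point of an iterate is a fixed point of the map
  itself. Expressing this fixed point through the orbit of \<open>0\<close> bounds it by a multiple of \<open>y\<close>.
\<close>

lemma invertible_id_minus_power_contraction:
  fixes T :: "'a::complex_banach \<Rightarrow> 'a"
  assumes T: "bounded_clinear T" and contr: "\<And>x. 2 * norm ((T ^^ m) x) \<le> norm x"
  shows "invertible_operator (\<lambda>x. x - T x)"
proof -
  have bl: "bounded_linear T"
    using T by (simp add: bounded_clinear_def)
  then have lin: "linear T"
    by (rule bounded_linear.linear)
  define F where "F y x = T x + y" for y x
  have affine: "(F y ^^ k) x = (T ^^ k) x + (F y ^^ k) 0" for y x k
    by (induction k) (simp_all add: F_def linear_add[OF lin])
  \<comment> \<open>This orbit point is the sum of the vectors \<open>(T ^^ i) y\<close> with \<open>i < k\<close>.\<close>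
  have "\<exists>C. \<forall>y. norm ((F y ^^ k) 0) \<le> C * norm y" for k
  proof (induction k)
    case 0
    show ?case by (auto intro: exI[of _ 0])
  next
    case (Suc k)
    then obtain C where C: "norm ((F y ^^ k) 0) \<le> C * norm y" for y
      by blast
    obtain K where "K > 0" and K: "norm (T x) \<le> norm x * K" for x
      using bounded_linear.pos_bounded[OF bl] by blast
    have "norm ((F y ^^ Suc k) 0) \<le> (C * K + 1) * norm y" for y
    proof -
      have "norm ((F y ^^ Suc k) 0) \<le> norm (T ((F y ^^ k) 0)) + norm y"
        by (simp add: F_def norm_triangle_ineq)
      also have "\<dots> \<le> C * norm y * K + norm y"
        using K[of "(F y ^^ k) 0"] mult_right_mono[OF C[of y], of K] \<open>K > 0\<close> by linarith
      finally show ?thesis by (simp add: algebra_simps)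
    qed
    then show ?case by blast
  qed
  then obtain C where C: "norm ((F y ^^ m) 0) \<le> C * norm y" for y
    by blast
  show ?thesis
  proof (rule invertible_operatorI_bounded_below)
    show "bounded_clinear (\<lambda>x. x - T x)"
      using bounded_clinear_diff[OF bounded_clinear_scaleC[of 1] T] by (simp add: scaleC_one)
    show "norm x \<le> 2 * C * norm (x - T x)" for x
    proof -
      let ?y = "x - T x"
      have "(F ?y ^^ m) x = x"
        by (induction m) (simp_all add: F_def)
      then have "norm x \<le> norm ((T ^^ m) x) + norm ((F ?y ^^ m) 0)"
        using affine[where y = ?y and x = x and k = m] norm_triangle_ineq by metis
      then show ?thesis
        using contr[of x] C[of ?y] by linarith
    qed
    have "\<exists>x. x - T x = y" for y
    proof -
      have "\<exists>!x. (F y ^^ m) x = x"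
      proof (rule banach_fix_type)
        show "\<forall>x x'. dist ((F y ^^ m) x) ((F y ^^ m) x') \<le> 1/2 * dist x x'"
        proof (intro allI)
          fix x x'
          have "(F y ^^ m) x - (F y ^^ m) x' = (T ^^ m) (x - x')"
            by (subst (1 2) affine) (simp add: linear_diff[OF linear_funpow[OF lin]])
          then show "dist ((F y ^^ m) x) ((F y ^^ m) x') \<le> 1/2 * dist x x'"
            using contr[of "x - x'"] by (simp add: dist_norm)
        qed
      qed auto
      then obtain x where x: "(F y ^^ m) x = x"
        and unique: "\<And>x'. (F y ^^ m) x' = x' \<Longrightarrow> x' = x"
        by blast
      have "(F y ^^ m) (F y x) = F y x"
        by (simp add: x flip: funpow_swap1)
      then have "F y x = x"
        by (rule unique)
      then show ?thesis
        by (intro exI[of _ x]) (simp add: F_def algebra_simps)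
    qed
    then show "surj (\<lambda>x. x - T x)"
      unfolding surj_def by metis
  qed
qed


section \<open>Bounded half-orbits of a uniformly expansive map\<close>

definition bounded_orbits :: "('a::real_normed_vector \<Rightarrow> 'a) \<Rightarrow> 'a set"
  where "bounded_orbits T = {x. bounded (range (\<lambda>n. (T ^^ n) x))}"

lemma subspace_bounded_orbits:
  assumes "linear T"
  shows "subspace (bounded_orbits T)"
proof -
  note lin = linear_funpow[OF assms]
  show ?thesis
    unfolding subspace_def bounded_orbits_def
    by (auto simp: linear_0[OF lin] linear_add[OF lin] linear_scale[OF lin]
        intro!: bounded_plus_comp bounded_scaleR_comp)
qed

lemma funpow_inverse:
  fixes f g :: "'a \<Rightarrow> 'a"
  assumes "\<And>x. g (f x) = x"
  shows "(g ^^ n) ((f ^^ n) x) = x"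
proof (induction n)
  case (Suc n)
  have "(g ^^ Suc n) ((f ^^ Suc n) x) = (g ^^ n) (g (f ((f ^^ n) x)))"
    by (simp only: funpow_Suc_right[of n g] funpow.simps(2)[of n f] comp_apply)
  with Suc show ?case
    by (simp only: assms)
qed simp

text \<open>
  Keeping the inverse \<open>T'\<close> as a parameter makes the situation symmetric under exchange of the two
  maps, so that statements on forward orbits also serve for backward ones.
\<close>

locale expansive_pair =
  fixes T T' :: "'a::real_normed_vector \<Rightarrow> 'a" and m :: nat
  assumes linear: "linear T" "linear T'"
    and inverse: "T' (T x) = x" "T (T' x) = x"
    and expansive: "2 * norm x \<le> norm ((T ^^ m) x) \<or> 2 * norm x \<le> norm ((T' ^^ m) x)"
begin

text \<open>
  If \<open>T ^^ m\<close> at least doubles \<open>y\<close>, then \<open>T' ^^ m\<close> takes \<open>(T ^^ m) y\<close> back to the shorter vector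
  \<open>y\<close>; hence at \<open>(T ^^ m) y\<close> expansivity can only act forward again.
\<close>

lemma growth_persists:
  assumes "2 * norm x \<le> norm ((T ^^ m) x)"
  shows "2 ^ k * norm x \<le> norm ((T ^^ (m * k)) x)"
proof -
  have "2 * norm ((T ^^ (m * k)) x) \<le> norm ((T ^^ (m * Suc k)) x)
      \<and> 2 ^ k * norm x \<le> norm ((T ^^ (m * k)) x)" for k
  proof (induction k)
    case 0
    then show ?case using assms by simp
  next
    case (Suc k)
    let ?y = "(T ^^ (m * k)) x"
    have step: "(T ^^ (m * Suc j)) x = (T ^^ m) ((T ^^ (m * j)) x)" for j
      by (simp add: funpow_add)
    have undo: "(T' ^^ m) ((T ^^ m) ?y) = ?y"
      by (rule funpow_inverse) (rule inverse)
    have up: "2 * norm ?y \<le> norm ((T ^^ m) ?y)"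
      using Suc step by metis
    have "2 * norm ((T ^^ m) ?y) \<le> norm ((T ^^ m) ((T ^^ m) ?y))"
      using expansive[of "(T ^^ m) ?y"]
    proof
      assume "2 * norm ((T ^^ m) ?y) \<le> norm ((T' ^^ m) ((T ^^ m) ?y))"
      with up have "norm ((T ^^ m) ?y) \<le> 0"
        unfolding undo using norm_ge_zero[of ?y] by linarith
      then show ?thesis
        by (simp add: linear_0[OF linear_funpow[OF linear(1)]])
    qed
    moreover have "2 ^ Suc k * norm x \<le> norm ((T ^^ m) ?y)"
      using Suc up by simp
    ultimately show ?case
      by (simp only: step)
  qed
  then show ?thesis by blast
qed

text \<open>
  A bounded orbit can never start to grow, so at the nonzero vector \<open>(T ^^ m) x\<close> expansivity must
  act backward, where it compares with \<open>x\<close>.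
\<close>

lemma bounded_orbit_contracts:
  assumes x: "x \<in> bounded_orbits T"
  shows "2 * norm ((T ^^ m) x) \<le> norm x"
proof (cases "(T ^^ m) x = 0")
  case False
  let ?y = "(T ^^ m) x"
  obtain B where B: "norm ((T ^^ n) x) \<le> B" for n
    using x by (auto simp: bounded_orbits_def bounded_iff)
  have "\<not> 2 * norm ?y \<le> norm ((T ^^ m) ?y)"
  proof
    assume "2 * norm ?y \<le> norm ((T ^^ m) ?y)"
    then have "2 ^ k * norm ?y \<le> norm ((T ^^ (m * k)) ?y)" for k
      by (rule growth_persists)
    also have "norm ((T ^^ (m * k)) ?y) \<le> B" for k
      using B[of "m * k + m"] by (simp add: funpow_add)
    finally have "2 ^ k \<le> B / norm ?y" for k
      using False by (simp add: field_simps)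
    moreover obtain k where "B / norm ?y < 2 ^ k"
      using real_arch_pow[of 2 "B / norm ?y"] by auto
    ultimately show False
      by (meson not_le)
  qed
  with expansive[of ?y] have "2 * norm ?y \<le> norm ((T' ^^ m) ?y)"
    by blast
  moreover have "(T' ^^ m) ?y = x"
    by (rule funpow_inverse) (rule inverse)
  ultimately show ?thesis
    by simp
qed simp

end

lemma expansive_pair_sym: "expansive_pair T T' m \<Longrightarrow> expansive_pair T' T m"
  unfolding expansive_pair_def by blast

context expansive_pair
begin

interpretation reverse: expansive_pair T' T m
  by (rule expansive_pair_sym) unfold_locales

lemma bounded_orbits_trivial_inter: "bounded_orbits T \<inter> bounded_orbits T' \<subseteq> {0}"
proof
  fix x
  assume "x \<in> bounded_orbits T \<inter> bounded_orbits T'"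
  then have "2 * norm ((T ^^ m) x) \<le> norm x" "2 * norm ((T' ^^ m) x) \<le> norm x"
    by (simp_all add: bounded_orbit_contracts reverse.bounded_orbit_contracts)
  with expansive[of x] have "norm x \<le> 0"
    using norm_ge_zero[of x] by linarith
  then show "x \<in> {0}" by simp
qed

lemma backward_bounded_grows:
  assumes "x \<in> bounded_orbits T'"
  shows "2 ^ k * norm x \<le> norm ((T ^^ (m * k)) x)"
proof (cases "x = 0")
  case False
  then have "\<not> 2 * norm x \<le> norm ((T' ^^ m) x)"
    using reverse.bounded_orbit_contracts[OF assms] norm_ge_zero[of "(T' ^^ m) x"]
    by (smt (verit) zero_less_norm_iff)
  with expansive[of x] show ?thesis
    using growth_persists by blast
qed simp

end

lemma expansive_pair_inv:
  fixes L :: "'a::real_normed_vector \<Rightarrow> 'a"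
  assumes lin: "linear L" and "bij L" and "uniformly_expansive L"
  obtains m where "expansive_pair L (inv L) m"
proof -
  obtain m where unit: "norm x = 1 \<Longrightarrow> 2 \<le> norm ((L ^^ m) x) \<or> 2 \<le> norm ((inv L ^^ m) x)" for x
    using assms(3) unfolding uniformly_expansive_def iterate_def
    by (auto split: if_splits)
  have inverse: "inv L (L x) = x" "L (inv L x) = x" for x
    using \<open>bij L\<close> by (simp_all add: bij_is_inj bij_is_surj surj_f_inv_f)
  have lin': "linear (inv L)"
    using linear_inv[OF lin inverse(2,1)] .
  show thesis
  proof (rule that, rule expansive_pair.intro[OF lin lin' inverse])
    fix x :: 'a
    show "2 * norm x \<le> norm ((L ^^ m) x) \<or> 2 * norm x \<le> norm ((inv L ^^ m) x)"
    proof (cases "x = 0")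
      case False
      then show ?thesis
        using unit[of "inverse (norm x) *\<^sub>R x"]
        by (simp add: linear_scale[OF linear_funpow[OF lin]]
            linear_scale[OF linear_funpow[OF lin']] field_simps)
    qed simp
  qed
qed

section \<open>Shadowing an orbit that switches\<close>

lemma iterate_step:
  assumes "bij f"
  shows "f (iterate f n x) = iterate f (n + 1) x"
proof (cases "0 \<le> n")
  case True
  then show ?thesis
    by (simp add: iterate_def nat_add_distrib)
next
  case False
  then have "nat (- n) = Suc (nat (- (n + 1)))"
    by simp
  then have "iterate f n x = inv f ((inv f ^^ nat (- (n + 1))) x)"
    using False by (simp add: iterate_def)
  with False show ?thesis
    using \<open>bij f\<close> by (cases "n = -1") (simp_all add: iterate_def bij_is_surj surj_f_inv_f)
qed

text \<open>
  The pseudo orbit runs along the orbit of \<open>a\<close> at negative times and along that of \<open>b\<close> from time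
  \<open>0\<close> on. Its only error occurs at the step from time \<open>-1\<close>, where \<open>a\<close> is replaced by \<open>b\<close>.
\<close>

lemma shadowing_switch:
  fixes L :: "'a::real_normed_vector \<Rightarrow> 'a"
  assumes "bij L" and "topological_shadowing L"
  obtains \<delta> where "\<delta> \<in> Cplus"
    and "\<And>a b. dist a b < \<delta> a \<Longrightarrow> \<exists>z.
      (\<forall>n. norm ((L ^^ n) z - (L ^^ n) b) < exp (- norm ((L ^^ n) z))) \<and>
      (\<forall>n>0. norm ((inv L ^^ n) z - (inv L ^^ n) a) < exp (- norm ((inv L ^^ n) z)))"
proof -
  have "(\<lambda>y::'a. exp (- norm y)) \<in> Cplus"
    by (auto simp: Cplus_def intro!: continuous_intros)
  then obtain \<delta> where \<delta>: "\<delta> \<in> Cplus"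
    and shadow: "\<And>x. pseudo_orbit L \<delta> x \<Longrightarrow> shadowed L (\<lambda>y. exp (- norm y)) x"
    using assms(2) unfolding topological_shadowing_def by blast
  show thesis
  proof (rule that[OF \<delta>])
    fix a b :: 'a
    assume ab: "dist a b < \<delta> a"
    define x where "x n = iterate L n (if n < 0 then a else b)" for n
    have "pseudo_orbit L \<delta> x"
      unfolding pseudo_orbit_def
    proof
      fix n
      show "dist (L (x n)) (x (n + 1)) < \<delta> (L (x n))"
      proof (cases "n = -1")
        case True
        then have "L (x n) = a" "x (n + 1) = b"
          using iterate_step[OF \<open>bij L\<close>, of n a] by (simp_all add: x_def iterate_def)
        with ab show ?thesis by simp
      next
        case False
        then have "L (x n) = x (n + 1)"
          by (simp add: x_def iterate_step[OF \<open>bij L\<close>])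
        then show ?thesis
          using \<delta> by (simp add: Cplus_def)
      qed
    qed
    then obtain z where
      z: "dist (iterate L n z) (x n) < exp (- norm (iterate L n z))" for n
      using shadow unfolding shadowed_def by blast
    have "norm ((L ^^ n) z - (L ^^ n) b) < exp (- norm ((L ^^ n) z))" for n
      using z[of "int n"] by (simp add: x_def iterate_def dist_norm)
    moreover have "norm ((inv L ^^ n) z - (inv L ^^ n) a) < exp (- norm ((inv L ^^ n) z))"
      if "n > 0" for n
      using z[of "- int n"] that by (simp add: x_def iterate_def dist_norm)
    ultimately show "\<exists>z.
      (\<forall>n. norm ((L ^^ n) z - (L ^^ n) b) < exp (- norm ((L ^^ n) z))) \<and>
      (\<forall>n>0. norm ((inv L ^^ n) z - (inv L ^^ n) a) < exp (- norm ((inv L ^^ n) z)))"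
      by blast
  qed
qed

lemma diff_in_bounded_orbitsI:
  assumes "linear T" and "\<And>n. n > 0 \<Longrightarrow> norm ((T ^^ n) z - (T ^^ n) x) \<le> B"
  shows "z - x \<in> bounded_orbits T"
proof -
  have "norm ((T ^^ n) (z - x)) \<le> max (norm (z - x)) B" for n
  proof (cases "n = 0")
    case False
    then show ?thesis
      using assms(2)[of n] by (simp add: linear_diff[OF linear_funpow[OF assms(1)]])
  qed simp
  then show ?thesis
    unfolding bounded_orbits_def bounded_iff by auto
qed

lemma less_exp_neg_norm_le_1: "r < exp (- norm x) \<Longrightarrow> r \<le> 1"
  by (erule order_trans[OF less_imp_le]) simp

lemma exists_small_multiple:
  fixes x :: "'a::real_normed_vector"
  assumes "0 < \<rho>"
  shows "\<exists>c>0. norm (c *\<^sub>R x) < \<rho>"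
proof (intro exI conjI)
  have pos: "0 < norm x + 1"
    by (simp add: add_nonneg_pos)
  with assms show "0 < \<rho> / (norm x + 1)"
    by simp
  have "\<rho> * norm x < \<rho> * (norm x + 1)"
    using assms by simp
  with pos assms show "norm ((\<rho> / (norm x + 1)) *\<^sub>R x) < \<rho>"
    by (simp add: pos_divide_less_eq)
qed

text \<open>
  Taking logarithms bounds \<open>2 ^ k * \<beta>\<close> by a function that is affine in \<open>k\<close>.
\<close>

lemma double_exponential_beats_exponential:
  fixes K :: real
  assumes "\<alpha> > 0" and "K > 0" and bound: "\<And>k. \<alpha> \<le> K ^ k * exp (B - 2 ^ k * \<beta>)"
  shows "\<beta> \<le> 0"
proof -
  have "ln \<alpha> \<le> ln (K ^ k * exp (B - 2 ^ k * \<beta>))" for k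
    using bound \<open>\<alpha> > 0\<close> \<open>K > 0\<close> by simp
  then have "ln \<alpha> \<le> real k * ln K + (B - 2 ^ k * \<beta>)" for k
    using \<open>K > 0\<close> by (simp add: ln_mult ln_realpow)
  then have "\<beta> \<le> ln K * (real k / 2 ^ k) + (B - ln \<alpha>) * (1 / 2) ^ k" for k
  proof -
    have "\<beta> \<le> (real k * ln K + (B - ln \<alpha>)) / 2 ^ k"
      using \<open>\<And>k. ln \<alpha> \<le> real k * ln K + (B - 2 ^ k * \<beta>)\<close>[of k]
      by (simp add: pos_le_divide_eq algebra_simps)
    then show ?thesis
      unfolding add_divide_distrib by (simp add: power_divide mult.commute)
  qed
  moreover have "(\<lambda>k. ln K * (real k / 2 ^ k) + (B - ln \<alpha>) * (1 / 2) ^ k)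
      \<longlonglongrightarrow> ln K * 0 + (B - ln \<alpha>) * 0"
    by (intro tendsto_intros lim_n_over_pown LIMSEQ_power_zero) auto
  ultimately show ?thesis
    by (intro LIMSEQ_le_const) auto
qed

text \<open>
  The differences \<open>z - b\<close> and \<open>z - a\<close> have a bounded forward and a bounded backward orbit, which
  forces \<open>z = a + b\<close>. The forward orbit of \<open>z\<close> then differs from that of \<open>b\<close> by the orbit of \<open>a\<close>,
  which can decay at most exponentially since \<open>T'\<close> is bounded. But the orbit of \<open>b\<close>, and with it
  that of \<open>z\<close>, grows exponentially, so that the allowed error \<open>exp (- norm ((T ^^ n) z))\<close> decays
  doubly exponentially.
\<close>

lemma (in expansive_pair) no_shadowed_switch:
  assumes bl: "bounded_linear T'"
    and a: "a \<in> bounded_orbits T" and b: "b \<in> bounded_orbits T'"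
    and z: "z - b \<in> bounded_orbits T \<and> z - a \<in> bounded_orbits T' \<and>
      (\<forall>n. norm ((T ^^ n) z - (T ^^ n) b) < exp (- norm ((T ^^ n) z)))"
  shows "a = 0 \<or> b = 0"
proof (cases "a = 0")
  case False
  have "z - a - b \<in> bounded_orbits T" "z - a - b \<in> bounded_orbits T'"
    using subspace_diff[OF subspace_bounded_orbits[OF linear(1)], of "z - b" a]
      subspace_diff[OF subspace_bounded_orbits[OF linear(2)], of "z - a" b] a b z
    by (simp_all add: algebra_simps)
  then have "z = a + b"
    using bounded_orbits_trivial_inter by fastforce
  then have diff: "norm ((T ^^ n) z - (T ^^ n) b) = norm ((T ^^ n) a)" for n
    by (simp add: linear_add[OF linear_funpow[OF linear(1)]])
  obtain B where B: "norm ((T ^^ n) a) \<le> B" for n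
    using a by (auto simp: bounded_orbits_def bounded_iff)
  obtain K where "K > 0" and K: "norm ((T' ^^ m) x) \<le> norm x * K" for x
    using bounded_linear.pos_bounded[OF bounded_linear_funpow[OF bl]] by blast
  have lower: "norm a \<le> K ^ k * norm ((T ^^ (m * k)) a)" for k
  proof (induction k)
    case (Suc k)
    have "(T ^^ (m * Suc k)) a = (T ^^ m) ((T ^^ (m * k)) a)"
      by (simp add: funpow_add)
    moreover have "(T' ^^ m) ((T ^^ m) y) = y" for y
      by (rule funpow_inverse) (rule inverse)
    ultimately have "norm ((T ^^ (m * k)) a) \<le> norm ((T ^^ (m * Suc k)) a) * K"
      using K by metis
    then have "K ^ k * norm ((T ^^ (m * k)) a) \<le> K ^ Suc k * norm ((T ^^ (m * Suc k)) a)"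
      using \<open>K > 0\<close> by (simp add: algebra_simps)
    with Suc show ?case by linarith
  qed simp
  have "norm a \<le> K ^ k * exp (B - 2 ^ k * norm b)" for k
  proof -
    have "2 ^ k * norm b - B \<le> norm ((T ^^ (m * k)) z)"
      using backward_bounded_grows[OF b, of k] B[of "m * k"] diff[of "m * k"]
        norm_triangle_sub[of "(T ^^ (m * k)) b" "(T ^^ (m * k)) z"]
      by (simp add: norm_minus_commute)
    then have "exp (- norm ((T ^^ (m * k)) z)) \<le> exp (B - 2 ^ k * norm b)"
      by simp
    then have "norm ((T ^^ (m * k)) a) \<le> exp (B - 2 ^ k * norm b)"
      using z diff[of "m * k"] by (metis less_imp_le order_trans)
    then have "K ^ k * norm ((T ^^ (m * k)) a) \<le> K ^ k * exp (B - 2 ^ k * norm b)"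
      using \<open>K > 0\<close> by (intro mult_left_mono) auto
    with lower[of k] show ?thesis by linarith
  qed
  with False \<open>K > 0\<close> have "norm b \<le> 0"
    by (intro double_exponential_beats_exponential[of "norm a" K B]) auto
  then show ?thesis by simp
qed simp

text \<open>
  Switching from the zero orbit to that of a small vector writes this vector as a difference of a
  backward bounded and a forward bounded one, and scaling extends this to all vectors. If neither
  kind were trivial, small nonzero vectors of both kinds would be close enough for a switch from
  the forward bounded one to the backward bounded one, which cannot be shadowed.
\<close>

lemma bounded_orbits_dichotomy:
  fixes L :: "'a::real_normed_vector \<Rightarrow> 'a"
  assumes pair: "expansive_pair L (inv L) m" and "bij L"
    and bl: "bounded_linear (inv L)" and "topological_shadowing L"
  shows "bounded_orbits L = UNIV \<or> bounded_orbits (inv L) = UNIV"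
proof -
  interpret expansive_pair L "inv L" m
    by (rule pair)
  let ?S = "bounded_orbits L" and ?U = "bounded_orbits (inv L)"
  note S = subspace_bounded_orbits[OF linear(1)] and U = subspace_bounded_orbits[OF linear(2)]
  obtain \<delta> where \<delta>: "\<delta> \<in> Cplus"
    and switch: "\<And>a b. dist a b < \<delta> a \<Longrightarrow> \<exists>z.
      (\<forall>n. norm ((L ^^ n) z - (L ^^ n) b) < exp (- norm ((L ^^ n) z))) \<and>
      (\<forall>n>0. norm ((inv L ^^ n) z - (inv L ^^ n) a) < exp (- norm ((inv L ^^ n) z)))"
    using shadowing_switch[OF assms(2,4)] by blast
  have connect: "\<exists>z. z - b \<in> ?S \<and> z - a \<in> ?U \<and>
      (\<forall>n. norm ((L ^^ n) z - (L ^^ n) b) < exp (- norm ((L ^^ n) z)))"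
    if ab: "dist a b < \<delta> a" for a b
  proof -
    obtain z where
      f: "\<And>n. norm ((L ^^ n) z - (L ^^ n) b) < exp (- norm ((L ^^ n) z))" and
      p: "\<And>n. n > 0 \<Longrightarrow> norm ((inv L ^^ n) z - (inv L ^^ n) a) < exp (- norm ((inv L ^^ n) z))"
      using switch[OF ab] by blast
    have "z - b \<in> ?S"
      by (rule diff_in_bounded_orbitsI[OF linear(1) less_exp_neg_norm_le_1[OF f]])
    moreover have "z - a \<in> ?U"
      by (rule diff_in_bounded_orbitsI[OF linear(2) less_exp_neg_norm_le_1[OF p]])
    ultimately show ?thesis
      using f by blast
  qed
  have "\<delta> 0 > 0"
    using \<delta> by (simp add: Cplus_def)
  \<comment> \<open>A switch at \<open>a = 0\<close>, for a multiple of \<open>x\<close> that is small compared to \<open>\<delta> 0\<close>.\<close>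
  have decompose: "\<exists>s\<in>?S. \<exists>u\<in>?U. x = s + u" for x
  proof -
    obtain c where "c > 0" "norm (c *\<^sub>R x) < \<delta> 0"
      using exists_small_multiple[OF \<open>\<delta> 0 > 0\<close>] by blast
    then obtain z where z: "z - c *\<^sub>R x \<in> ?S" "z \<in> ?U"
      using connect[of 0 "c *\<^sub>R x"] by auto
    have "x = (- inverse c) *\<^sub>R (z - c *\<^sub>R x) + inverse c *\<^sub>R z"
      using \<open>c > 0\<close> by (simp add: algebra_simps)
    then show ?thesis
      using z subspace_mul[OF S] subspace_mul[OF U] by blast
  qed
  have no_switch: False
    if a: "a \<in> ?S" "a \<noteq> 0" and b: "b \<in> ?U" "b \<noteq> 0" and ab: "dist a b < \<delta> a" for a b
    using connect[OF ab] no_shadowed_switch[OF bl a(1) b(1)] a(2) b(2) by blast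
  \<comment> \<open>Near \<open>0\<close> the function \<open>\<delta>\<close> stays above \<open>\<delta> 0 / 2\<close>, so two vectors of norm below \<open>\<delta> 0 / 4\<close>
    in that neighbourhood allow a switch.\<close>
  have "?S \<subseteq> {0} \<or> ?U \<subseteq> {0}"
  proof -
    have cont: "isCont \<delta> 0"
      using \<delta> by (simp add: Cplus_def continuous_on_eq_continuous_at)
    have "\<exists>r>0. \<forall>y. norm y < r \<longrightarrow> \<delta> 0 / 2 < \<delta> y"
    proof -
      have "eventually (\<lambda>y. \<delta> 0 / 2 < \<delta> y) (nhds 0)"
        using cont \<open>\<delta> 0 > 0\<close> unfolding isCont_def tendsto_at_iff_tendsto_nhds
        by (intro order_tendstoD) auto
      then show ?thesis
        by (auto simp: eventually_nhds_metric)
    qed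
    then obtain r where "r > 0" and r: "norm y < r \<Longrightarrow> \<delta> 0 / 2 < \<delta> y" for y
      by blast
    define \<rho> where "\<rho> = min r (\<delta> 0 / 4)"
    have "\<rho> > 0"
      using \<open>r > 0\<close> \<open>\<delta> 0 > 0\<close> by (simp add: \<rho>_def)
    show ?thesis
    proof (rule ccontr)
      assume "\<not> ?thesis"
      then obtain a b where ab: "a \<in> ?S" "a \<noteq> 0" "b \<in> ?U" "b \<noteq> 0"
        by blast
      obtain c d where cd: "c > 0" "norm (c *\<^sub>R a) < \<rho>" "d > 0" "norm (d *\<^sub>R b) < \<rho>"
        using exists_small_multiple[OF \<open>\<rho> > 0\<close>] by meson
      have "dist (c *\<^sub>R a) (d *\<^sub>R b) < \<delta> 0 / 2"
        using cd norm_triangle_ineq4[of "c *\<^sub>R a" "d *\<^sub>R b"] unfolding \<rho>_def dist_norm by linarith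
      also have "\<dots> < \<delta> (c *\<^sub>R a)"
        using cd by (intro r) (simp add: \<rho>_def)
      finally show False
        using no_switch[of "c *\<^sub>R a" "d *\<^sub>R b"] ab cd subspace_mul[OF S] subspace_mul[OF U] by simp
    qed
  qed
  then show ?thesis
  proof
    assume "?S \<subseteq> {0}"
    then have "x \<in> ?U" for x
      using decompose[of x] by auto
    then show ?thesis by blast
  next
    assume "?U \<subseteq> {0}"
    then have "x \<in> ?S" for x
      using decompose[of x] by auto
    then show ?thesis by blast
  qed
qed

section \<open>The spectrum\<close>

lemma funpow_scaleC:
  fixes T :: "'a::complex_normed_vector \<Rightarrow> 'a"
  assumes "bounded_clinear T"
  shows "((\<lambda>x. c *\<^sub>C T x) ^^ n) x = c ^ n *\<^sub>C (T ^^ n) x"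
  using assms
  by (induction n) (simp_all add: scaleC_one scaleC_scaleC bounded_clinear_def mult.commute)

lemma invertible_id_minus_scaled:
  fixes T :: "'a::complex_banach \<Rightarrow> 'a"
  assumes T: "bounded_clinear T" and contr: "\<And>x. 2 * norm ((T ^^ m) x) \<le> norm x"
    and "cmod c \<le> 1"
  shows "invertible_operator (\<lambda>x. x - c *\<^sub>C T x)"
proof (rule invertible_id_minus_power_contraction)
  show "bounded_clinear (\<lambda>x. c *\<^sub>C T x)"
    using bounded_clinear_comp[OF bounded_clinear_scaleC T] by (simp add: comp_def)
  fix x
  have "cmod c ^ m * norm ((T ^^ m) x) \<le> norm ((T ^^ m) x)"
    using \<open>cmod c \<le> 1\<close> by (simp add: mult_left_le_one_le power_le_one)
  then show "2 * norm (((\<lambda>x. c *\<^sub>C T x) ^^ m) x) \<le> norm x"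
    using contr[of x] by (simp add: funpow_scaleC[OF T] norm_scaleC norm_power)
qed

theorem theoremB:
  fixes L :: "'a::complex_banach \<Rightarrow> 'a"
  assumes "\<exists>x::'a. x \<noteq> 0"
    and "bounded_clinear L"
    and "invertible_operator L"
    and "uniformly_expansive L"
    and "topological_shadowing L"
  shows "spectrum L \<subseteq> ball 0 1 \<or> spectrum L \<subseteq> - cball 0 1"
proof -
  obtain R where R: "bounded_clinear R" "R \<circ> L = id" "L \<circ> R = id"
    using assms(3) unfolding invertible_operator_def by blast
  then have "bij L" "inv L = R"
    by (simp_all add: o_bij inv_unique_comp)
  with R have inv: "bounded_clinear (inv L)" "L (inv L x) = x" for x
    by (simp_all add: pointfree_idE)
  have C_lin: "L (c *\<^sub>C x) = c *\<^sub>C L x" and diff: "L (x - y) = L x - L y" for c x y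
    using assms(2) by (simp_all add: bounded_clinear_def bounded_linear.linear linear_diff)
  have bl: "bounded_linear L" "bounded_linear (inv L)"
    using assms(2) inv by (simp_all add: bounded_clinear_def)
  obtain m where pair: "expansive_pair L (inv L) m"
    using expansive_pair_inv[OF bounded_linear.linear[OF bl(1)] \<open>bij L\<close> assms(4)] by blast
  note contracts = expansive_pair.bounded_orbit_contracts
  from bounded_orbits_dichotomy[OF pair \<open>bij L\<close> bl(2) assms(5)] show ?thesis
  proof
    assume "bounded_orbits L = UNIV"
    then have contr: "2 * norm ((L ^^ m) x) \<le> norm x" for x
      using contracts[OF pair] by simp
    have "invertible_operator (\<lambda>x. L x - z *\<^sub>C x)" if "1 \<le> cmod z" for z
    proof -
      have "z \<noteq> 0" using that by auto
      have "invertible_operator (\<lambda>x. x - inverse z *\<^sub>C L x)"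
        using that by (intro invertible_id_minus_scaled[OF assms(2) contr])
          (simp add: norm_inverse inverse_le_1_iff)
      moreover have "(\<lambda>x. L x - z *\<^sub>C x) = (\<lambda>x. (- z) *\<^sub>C x) \<circ> (\<lambda>x. x - inverse z *\<^sub>C L x)"
      proof
        fix x
        show "L x - z *\<^sub>C x = ((\<lambda>x. (- z) *\<^sub>C x) \<circ> (\<lambda>x. x - inverse z *\<^sub>C L x)) x"
          using \<open>z \<noteq> 0\<close>
          by (simp add: scaleC_minus_left scaleC_diff_right scaleC_scaleC scaleC_one)
      qed
      ultimately show ?thesis
        using \<open>z \<noteq> 0\<close> by (simp only: invertible_operator_comp invertible_operator_scaleC neg_equal_0_iff_equal not_False_eq_True)
    qed
    then have "spectrum L \<subseteq> ball 0 1"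
      unfolding spectrum_def by (auto simp: not_le[symmetric])
    then show ?thesis ..
  next
    assume "bounded_orbits (inv L) = UNIV"
    then have contr: "2 * norm ((inv L ^^ m) x) \<le> norm x" for x
      using contracts[OF expansive_pair_sym[OF pair]] by simp
    have "invertible_operator (\<lambda>x. L x - z *\<^sub>C x)" if "cmod z \<le> 1" for z
    proof -
      have "(\<lambda>x. L x - z *\<^sub>C x) = L \<circ> (\<lambda>x. x - z *\<^sub>C inv L x)"
        by (simp add: fun_eq_iff C_lin diff inv(2))
      then show ?thesis
        using invertible_operator_comp[OF assms(3) invertible_id_minus_scaled[OF inv(1) contr that]]
        by simp
    qed
    then have "spectrum L \<subseteq> - cball 0 1"
      unfolding spectrum_def by auto
    then show ?thesis ..
  qed
qed

end
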